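(* Let $c=(c_n)_{n=-\infty}^\infty\subseteq\mathbb{H}$ be a non-trivial positive definite sequence with orthonormal polynomials $(\psi_n^L)_{n=0}^\infty$ and $(\psi_n^R)_{n=0}^\infty$. Then for all integers $n\ge0$ and all $p\in\mathbb{H}$ with $|p|\ne1$, $$\sum_{\ell=0}^n\Big(|\psi_\ell^L(p)|^2+|\psi_\ell^R(p)|^2\Big)=\frac{|\psi_{n+1}^{L,\#}(p)|^2+|\psi_{n+1}^{R,\#}(p)|^2-\big(|\psi_{n+1}^L(p)|^2+|\psi_{n+1}^R(p)|^2\big)}{1-|p|^2}$$ $$=\frac{|\psi_n^{L,\#}(p)|^2+|\psi_n^{R,\#}(p)|^2-|p|^2\big(|\psi_n^L(p)|^2+|\psi_n^R(p)|^2\big)}{1-|p|^2}.$$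
   Context: $\mathbb{H}$ is the quaternions. A bi-infinite sequence $c=(c_n)_{n\in\mathbb{Z}}$ in $\mathbb{H}$ is positive definite if for every $n\ge0$ the Toeplitz matrix $T_n(c)=[c_{\ell-k}]_{k,\ell=0}^n$ (row $k$, column $\ell$) is positive semidefinite ($\xi^*T_n(c)\xi\ge0$ for all $\xi\in\mathbb{H}^{n+1}$), and is non-trivial if moreover every $T_n(c)$ is positive definite ($\xi^*T_n(c)\xi>0$ for all nonzero $\xi\in\mathbb{H}^{n+1}$). Then $c_{-n}=\overline{c_n}$. $\mathbb{H}[p]^L$ is the set of polynomials $\sum_k p^k\varphi_k$ and $\mathbb{H}[p]^R$ the set of polynomials $\sum_k\varphi_kp^k$, with $\varphi_k\in\mathbb{H}$. On $\mathbb{H}[p]^L$ put $\langle\varphi,\psi\rangle_R=\sum_{k,\ell}\overline{\psi_\ell}\,c_{k-\ell}\,\varphi_k$; on $\mathbb{H}[p]^R$ put $\langle\varphi,\psi\rangle_L=\sum_{k,\ell}\varphi_k\,c_{k-\ell}\,\overline{\psi_\ell}$. The right-orthonormal polynomials $(\psi_n^R)_{n\ge0}\subset\mathbb{H}[p]^L$ (coefficients on the right) and the left-orthonormal polynomials $(\psi_n^L)_{n\ge0}\subset\mathbb{H}[p]^R$ (coefficients on the left) are obtained from $1,p,p^2,\dots$ by the Gram–Schmidt algorithm with respect to $\langle\cdot,\cdot\rangle_R$ and $\langle\cdot,\cdot\rangle_L$ respectively; thus $\psi_n^{R},\psi_n^L$ have degree $n$ and positive real leading coefficient. Reverse polynomials: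 for $\varphi(p)=\sum_{k=0}^np^k\varphi_k\in\mathbb{H}[p]^L$ of degree $n$, $\varphi^\#(p)=\overline{\varphi(1/\overline p)}\,p^n=\sum_k\overline{\varphi_k}\,p^{n-k}\in\mathbb{H}[p]^R$; for $\psi(p)=\sum_{k=0}^n\psi_kp^k\in\mathbb{H}[p]^R$ of degree $n$, $\psi^\#(p)=p^n\,\overline{\psi(1/\overline p)}=\sum_kp^{n-k}\,\overline{\psi_k}\in\mathbb{H}[p]^L$; $\psi_n^{L,\#}=(\psi_n^L)^\#$, $\psi_n^{R,\#}=(\psi_n^R)^\#$. *)

theory Defs
  imports "HOL-Analysis.Inner_Product" "HOL-Computational_Algebra.Polynomial"
begin

section \<open>The quaternions\<close>

text \<open>\<open>Quat a b c d\<close> stands for $a + bi + cj + dk$.\<close>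

datatype quat = Quat (qRe: real) (qI: real) (qJ: real) (qK: real)

lemma quat_eq_iff:
  "x = y \<longleftrightarrow> qRe x = qRe y \<and> qI x = qI y \<and> qJ x = qJ y \<and> qK x = qK y"
  by (cases x; cases y) auto

instantiation quat :: ab_group_add
begin

definition "0 = Quat 0 0 0 0"
definition "x + y = Quat (qRe x + qRe y) (qI x + qI y) (qJ x + qJ y) (qK x + qK y)"
definition "x - y = Quat (qRe x - qRe y) (qI x - qI y) (qJ x - qJ y) (qK x - qK y)"
definition "- x = Quat (- qRe x) (- qI x) (- qJ x) (- qK x)"

instance
  by standard
    (simp_all add: quat_eq_iff zero_quat_def plus_quat_def minus_quat_def uminus_quat_def)

end

lemma quat_zero_sel [simp]: "qRe 0 = 0" "qI 0 = 0" "qJ 0 = 0" "qK 0 = 0"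
  by (simp_all add: zero_quat_def)

lemma quat_add_sel [simp]:
  "qRe (x + y) = qRe x + qRe y" "qI (x + y) = qI x + qI y"
  "qJ (x + y) = qJ x + qJ y" "qK (x + y) = qK x + qK y"
  by (simp_all add: plus_quat_def)

lemma quat_diff_sel [simp]:
  "qRe (x - y) = qRe x - qRe y" "qI (x - y) = qI x - qI y"
  "qJ (x - y) = qJ x - qJ y" "qK (x - y) = qK x - qK y"
  by (simp_all add: minus_quat_def)

lemma quat_minus_sel [simp]:
  "qRe (- x) = - qRe x" "qI (- x) = - qI x" "qJ (- x) = - qJ x" "qK (- x) = - qK x"
  by (simp_all add: uminus_quat_def)

instantiation quat :: ring_1
begin

definition "1 = Quat 1 0 0 0"
definition "x * y = Quat
  (qRe x * qRe y - qI x * qI y - qJ x * qJ y - qK x * qK y)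
  (qRe x * qI y + qI x * qRe y + qJ x * qK y - qK x * qJ y)
  (qRe x * qJ y - qI x * qK y + qJ x * qRe y + qK x * qI y)
  (qRe x * qK y + qI x * qJ y - qJ x * qI y + qK x * qRe y)"

instance
  by standard
    (simp_all add: quat_eq_iff one_quat_def times_quat_def algebra_simps)

end

lemma quat_one_sel [simp]: "qRe 1 = 1" "qI 1 = 0" "qJ 1 = 0" "qK 1 = 0"
  by (simp_all add: one_quat_def)

lemma quat_mult_sel [simp]:
  "qRe (x * y) = qRe x * qRe y - qI x * qI y - qJ x * qJ y - qK x * qK y"
  "qI (x * y) = qRe x * qI y + qI x * qRe y + qJ x * qK y - qK x * qJ y"
  "qJ (x * y) = qRe x * qJ y - qI x * qK y + qJ x * qRe y + qK x * qI y"
  "qK (x * y) = qRe x * qK y + qI x * qJ y - qJ x * qI y + qK x * qRe y"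
  by (simp_all add: times_quat_def)

instantiation quat :: real_algebra_1
begin

definition "scaleR r x = Quat (r * qRe x) (r * qI x) (r * qJ x) (r * qK x)"

instance
  by standard (simp_all add: quat_eq_iff scaleR_quat_def algebra_simps)

end

lemma quat_scaleR_sel [simp]:
  "qRe (r *\<^sub>R x) = r * qRe x" "qI (r *\<^sub>R x) = r * qI x"
  "qJ (r *\<^sub>R x) = r * qJ x" "qK (r *\<^sub>R x) = r * qK x"
  by (simp_all add: scaleR_quat_def)

instantiation quat :: real_inner
begin

definition "inner x y = qRe x * qRe y + qI x * qI y + qJ x * qJ y + qK x * qK y"
definition "norm x = sqrt ((qRe x)\<^sup>2 + (qI x)\<^sup>2 + (qJ x)\<^sup>2 + (qK x)\<^sup>2)"
definition "sgn x = x /\<^sub>R norm x" for x :: quat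
definition "dist x y = norm (x - y)" for x y :: quat
definition [code del]:
  "(uniformity :: (quat \<times> quat) filter) = (INF e\<in>{0<..}. principal {(x, y). dist x y < e})"
definition [code del]:
  "open (U :: quat set) \<longleftrightarrow> (\<forall>x\<in>U. eventually (\<lambda>(x', y). x' = x \<longrightarrow> y \<in> U) uniformity)"

instance
proof
  fix x y z :: quat and r :: real
  show "dist x y = norm (x - y)" by (rule dist_quat_def)
  show "sgn x = x /\<^sub>R norm x" by (rule sgn_quat_def)
  show "(uniformity :: (quat \<times> quat) filter) = (INF e\<in>{0<..}. principal {(x, y). dist x y < e})"
    by (rule uniformity_quat_def)
  show "open U \<longleftrightarrow> (\<forall>x\<in>U. eventually (\<lambda>(x', y). x' = x \<longrightarrow> y \<in> U) uniformity)" for U :: "quat set"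
    by (rule open_quat_def)
  show "inner x y = inner y x" by (simp add: inner_quat_def mult.commute)
  show "inner (x + y) z = inner x z + inner y z" by (simp add: inner_quat_def algebra_simps)
  show "inner (r *\<^sub>R x) y = r * inner x y" by (simp add: inner_quat_def algebra_simps)
  show "0 \<le> inner x x" by (simp add: inner_quat_def)
  show "inner x x = 0 \<longleftrightarrow> x = 0"
    by (simp add: inner_quat_def quat_eq_iff add_nonneg_eq_0_iff)
  show "norm x = sqrt (inner x x)" by (simp add: inner_quat_def norm_quat_def power2_eq_square)
qed

end

definition qcnj :: "quat \<Rightarrow> quat" where
  "qcnj x = Quat (qRe x) (- qI x) (- qJ x) (- qK x)"

lemma qcnj_sel [simp]:
  "qRe (qcnj x) = qRe x" "qI (qcnj x) = - qI x" "qJ (qcnj x) = - qJ x" "qK (qcnj x) = - qK x"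
  by (simp_all add: qcnj_def)

lemma norm_quat_sq: "(norm x)\<^sup>2 = (qRe x)\<^sup>2 + (qI x)\<^sup>2 + (qJ x)\<^sup>2 + (qK x)\<^sup>2" for x :: quat
  by (simp add: norm_quat_def)

lemma mult_qcnj: "x * qcnj x = of_real ((norm x)\<^sup>2)"
  unfolding norm_quat_sq by (simp add: quat_eq_iff of_real_def power2_eq_square)

lemma qcnj_mult_self: "qcnj x * x = of_real ((norm x)\<^sup>2)"
  unfolding norm_quat_sq by (simp add: quat_eq_iff of_real_def power2_eq_square)

instantiation quat :: real_normed_div_algebra
begin

definition "inverse x = qcnj x /\<^sub>R (norm x)\<^sup>2"
definition "x div y = x * inverse y" for x y :: quat

instance
proof
  fix x y :: quat
  show "inverse x * x = 1" if "x \<noteq> 0"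
    using that by (simp add: inverse_quat_def qcnj_mult_self of_real_def
      del: of_real_power)
  show "x * inverse x = 1" if "x \<noteq> 0"
    using that by (simp add: inverse_quat_def mult_qcnj of_real_def
      del: of_real_power)
  show "x div y = x * inverse y" by (rule divide_quat_def)
  show "inverse (0 :: quat) = 0" by (simp add: inverse_quat_def)
  have "(norm (x * y))\<^sup>2 = (norm x * norm y)\<^sup>2"
    unfolding norm_quat_sq power_mult_distrib quat_mult_sel
    by (simp add: power2_eq_square algebra_simps)
  then show "norm (x * y) = norm x * norm y"
    by (simp add: power2_eq_iff_nonneg)
qed

end


section \<open>Positive definite sequences\<close>

definition toeplitz :: "(int \<Rightarrow> quat) \<Rightarrow> nat \<Rightarrow> nat \<Rightarrow> quat" where
  "toeplitz c k l = c (int l - int k)"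

text \<open>The value $\xi^* T_n(c)\, \xi$; the matrix $T_n(c)$ consists of the entries
  \<open>toeplitz c k l\<close> with \<open>k, l \<le> n\<close>, and a vector $\xi \in \mathbb{H}^{n+1}$ is given by the
  values \<open>\<xi> 0, \<dots>, \<xi> n\<close>.\<close>

definition toeplitz_form :: "(int \<Rightarrow> quat) \<Rightarrow> nat \<Rightarrow> (nat \<Rightarrow> quat) \<Rightarrow> quat" where
  "toeplitz_form c n \<xi> = (\<Sum>k\<le>n. \<Sum>l\<le>n. qcnj (\<xi> k) * toeplitz c k l * \<xi> l)"

text \<open>For a quaternion, $q \ge 0$ (resp. $q > 0$) includes the assertion that $q$ is real.\<close>

definition positive_definite_seq :: "(int \<Rightarrow> quat) \<Rightarrow> bool" where
  "positive_definite_seq c \<longleftrightarrow>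
    (\<forall>n \<xi>. \<exists>r\<ge>0. toeplitz_form c n \<xi> = of_real r)"

definition nontrivial_positive_definite_seq :: "(int \<Rightarrow> quat) \<Rightarrow> bool" where
  "nontrivial_positive_definite_seq c \<longleftrightarrow> positive_definite_seq c \<and>
    (\<forall>n \<xi>. (\<exists>k\<le>n. \<xi> k \<noteq> 0) \<longrightarrow> (\<exists>r>0. toeplitz_form c n \<xi> = of_real r))"


section \<open>Orthonormal polynomials\<close>

text \<open>An element of $\mathbb{H}[p]^L$ or of $\mathbb{H}[p]^R$ is represented by its coefficient
  sequence, of type \<^typ>\<open>quat poly\<close>.  The two spaces differ in the side on which the
  coefficients act: \<open>eval_coeffs_right\<close> is evaluation in $\mathbb{H}[p]^L$ and
  \<open>eval_coeffs_left\<close> is evaluation in $\mathbb{H}[p]^R$.  The ring structure of the type of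
  polynomials, in which the variable is central, is not used.\<close>

definition eval_coeffs_right :: "quat poly \<Rightarrow> quat \<Rightarrow> quat" where
  "eval_coeffs_right f p = (\<Sum>k\<le>degree f. p ^ k * coeff f k)"

definition eval_coeffs_left :: "quat poly \<Rightarrow> quat \<Rightarrow> quat" where
  "eval_coeffs_left f p = (\<Sum>k\<le>degree f. coeff f k * p ^ k)"

definition innerR :: "(int \<Rightarrow> quat) \<Rightarrow> quat poly \<Rightarrow> quat poly \<Rightarrow> quat" where
  "innerR c f g =
    (\<Sum>k\<le>degree f. \<Sum>l\<le>degree g. qcnj (coeff g l) * c (int k - int l) * coeff f k)"

definition innerL :: "(int \<Rightarrow> quat) \<Rightarrow> quat poly \<Rightarrow> quat poly \<Rightarrow> quat" where
  "innerL c f g =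
    (\<Sum>k\<le>degree f. \<Sum>l\<le>degree g. coeff f k * c (int k - int l) * qcnj (coeff g l))"

text \<open>The real number $\|f\| = \langle f, f\rangle^{1/2}$ is written as
  \<open>sqrt (qRe \<langle>f, f\<rangle>)\<close>, as $\langle f, f\rangle$ is real and nonnegative for a positive definite
  sequence.\<close>

definition normalizeR :: "(int \<Rightarrow> quat) \<Rightarrow> quat poly \<Rightarrow> quat poly" where
  "normalizeR c f = map_poly (\<lambda>a. a /\<^sub>R sqrt (qRe (innerR c f f))) f"

definition normalizeL :: "(int \<Rightarrow> quat) \<Rightarrow> quat poly \<Rightarrow> quat poly" where
  "normalizeL c f = map_poly (\<lambda>a. a /\<^sub>R sqrt (qRe (innerL c f f))) f"

text \<open>The Gram--Schmidt algorithm applied to $1, p, p^2, \dots$.  The projection coefficient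
  $\langle p^n, \psi_k\rangle$ multiplies $\psi_k$ from the side on which the inner product is
  linear in its first argument.\<close>

fun orthonormalR :: "(int \<Rightarrow> quat) \<Rightarrow> nat \<Rightarrow> quat poly" where
  "orthonormalR c n = normalizeR c (monom 1 n -
    (\<Sum>k<n. map_poly (\<lambda>a. a * innerR c (monom 1 n) (orthonormalR c k)) (orthonormalR c k)))"

fun orthonormalL :: "(int \<Rightarrow> quat) \<Rightarrow> nat \<Rightarrow> quat poly" where
  "orthonormalL c n = normalizeL c (monom 1 n -
    (\<Sum>k<n. map_poly (\<lambda>a. innerL c (monom 1 n) (orthonormalL c k) * a) (orthonormalL c k)))"

declare orthonormalR.simps [simp del] orthonormalL.simps [simp del]

text \<open>The coefficient of $p^k$ in the reverse polynomial of \<open>f\<close>, of degree $n$, is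
  $\overline{f_{n-k}}$.  The operation maps $\mathbb{H}[p]^L$ to $\mathbb{H}[p]^R$ and conversely,
  so the reverse polynomial has to be evaluated with the coefficients on the other side.\<close>

definition reverse_poly :: "quat poly \<Rightarrow> quat poly" where
  "reverse_poly f = map_poly qcnj (reflect_poly f)"

definition psiR :: "(int \<Rightarrow> quat) \<Rightarrow> nat \<Rightarrow> quat \<Rightarrow> quat" where
  "psiR c n = eval_coeffs_right (orthonormalR c n)"

definition psiL :: "(int \<Rightarrow> quat) \<Rightarrow> nat \<Rightarrow> quat \<Rightarrow> quat" where
  "psiL c n = eval_coeffs_left (orthonormalL c n)"

definition psiR_rev :: "(int \<Rightarrow> quat) \<Rightarrow> nat \<Rightarrow> quat \<Rightarrow> quat" where
  "psiR_rev c n = eval_coeffs_left (reverse_poly (orthonormalR c n))"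

definition psiL_rev :: "(int \<Rightarrow> quat) \<Rightarrow> nat \<Rightarrow> quat \<Rightarrow> quat" where
  "psiL_rev c n = eval_coeffs_right (reverse_poly (orthonormalL c n))"

end

theory Submission
  imports Defs
begin

text \<open>The right orthonormal polynomials satisfy
  \[ (1 - |p|^2) \sum_{\ell \le n} |\psi_\ell^R(p)|^2
     = |\psi_n^{L,\#}(p)|^2 - |p|^2 |\psi_n^R(p)|^2
     = |\psi_{n+1}^{L,\#}(p)|^2 - |\psi_{n+1}^R(p)|^2 \]
  on their own.  The second equality comes from the Szeg\H{o} recursion: with
  $u = p\,\psi_n^R$, $v = \psi_n^{L,\#}$ and $\alpha = \langle u, v\rangle_R$, the polynomials
  $u - v\alpha$ and $v - u\overline{\alpha}$ have the orthogonality properties that characterise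
  $\psi_{n+1}^R$ and $\psi_{n+1}^{L,\#}$ up to a right factor, which has modulus
  $(1 - |\alpha|^2)^{1/2}$ in both cases; the cross terms in the moduli of the values agree, even
  though the values do not commute.  The first equality then follows by induction.
  Reversing the indices and conjugating turns the left orthonormal polynomials of $(c_n)$
  into the right ones of $(c_{-n})$, evaluated at $\overline p$, and adding the two identities
  gives the theorem.\<close>

section \<open>Conjugation\<close>

lemma qcnj_0 [simp]: "qcnj 0 = 0"
  and qcnj_1 [simp]: "qcnj 1 = 1"
  and qcnj_qcnj [simp]: "qcnj (qcnj x) = x"
  and qcnj_add: "qcnj (x + y) = qcnj x + qcnj y"
  and qcnj_diff: "qcnj (x - y) = qcnj x - qcnj y"
  and qcnj_mult: "qcnj (x * y) = qcnj y * qcnj x"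
  by (simp_all add: quat_eq_iff)

lemma qcnj_eq_0_iff [simp]: "qcnj x = 0 \<longleftrightarrow> x = 0"
  by (auto simp: quat_eq_iff)

lemma qRe_of_real [simp]: "qRe (of_real r) = r"
  by (simp add: of_real_def)

lemma qcnj_of_real [simp]: "qcnj (of_real r) = of_real r"
  by (simp add: quat_eq_iff of_real_def)

lemma qcnj_scaleR: "qcnj (r *\<^sub>R x) = r *\<^sub>R qcnj x"
  by (simp add: quat_eq_iff)

lemma qcnj_sum: "qcnj (sum f A) = (\<Sum>i\<in>A. qcnj (f i))"
  by (induction A rule: infinite_finite_induct) (simp_all add: qcnj_add)

lemma qcnj_power: "qcnj (x ^ n) = qcnj x ^ n"
  by (induction n) (simp_all add: qcnj_mult power_commutes)

lemma norm_qcnj [simp]: "norm (qcnj x) = norm x"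
  by (simp add: norm_quat_def)

text \<open>For the real inner product, right multiplication by \<open>qcnj q\<close> is the adjoint
  of right multiplication by \<open>q\<close>. Hence the cross terms of both squares coincide and
  cancel, and what remains factors.\<close>

lemma norm_diff_mult_diff:
  fixes a b q :: quat
  shows "(norm (b - a * qcnj q))\<^sup>2 - (norm (a - b * q))\<^sup>2 =
    (1 - (norm q)\<^sup>2) * ((norm b)\<^sup>2 - (norm a)\<^sup>2)"
proof -
  have inner_mult: "inner b (a * qcnj q) = inner a (b * q)"
    by (simp add: inner_quat_def algebra_simps)
  have norm_diff: "(norm (x - y))\<^sup>2 = (norm x)\<^sup>2 - 2 * inner x y + (norm y)\<^sup>2" for x y :: quat
    by (simp add: power2_norm_eq_inner inner_diff_left inner_diff_right inner_commute)
  show ?thesis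
    by (simp add: norm_diff inner_mult norm_mult power_mult_distrib algebra_simps)
qed


section \<open>The right inner product\<close>

text \<open>The scalar action of the right module of polynomials with coefficients on the right; it
  is the operation that the Gram-Schmidt step applies to \<open>orthonormalR\<close>.\<close>

definition rscale :: "quat poly \<Rightarrow> quat \<Rightarrow> quat poly" where
  "rscale f q = map_poly (\<lambda>a. a * q) f"

lemma coeff_rscale [simp]: "coeff (rscale f q) k = coeff f k * q"
  by (simp add: rscale_def coeff_map_poly)

lemma degree_rscale_le: "degree (rscale f q) \<le> degree f"
  by (rule degree_le) (simp add: coeff_eq_0)

lemma rscale_rscale: "rscale (rscale f q) r = rscale f (q * r)"
  by (simp add: poly_eq_iff mult.assoc)

lemma rscale_1 [simp]: "rscale f 1 = f"
  by (simp add: poly_eq_iff)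

text \<open>Coefficients beyond the degree vanish, so polynomials of different degrees can be
  compared over common index ranges.\<close>

lemma innerR_bounded:
  assumes "degree f \<le> N" "degree g \<le> M"
  shows "innerR c f g =
    (\<Sum>k\<le>N. \<Sum>l\<le>M. qcnj (coeff g l) * c (int k - int l) * coeff f k)"
proof -
  have "(\<Sum>l\<le>degree g. qcnj (coeff g l) * c (int k - int l) * coeff f k) =
      (\<Sum>l\<le>M. qcnj (coeff g l) * c (int k - int l) * coeff f k)" for k
    using assms by (intro sum.mono_neutral_left) (auto simp: coeff_eq_0)
  moreover have "(\<Sum>k\<le>degree f. \<Sum>l\<le>M. qcnj (coeff g l) * c (int k - int l) * coeff f k) =
      (\<Sum>k\<le>N. \<Sum>l\<le>M. qcnj (coeff g l) * c (int k - int l) * coeff f k)"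
    using assms by (intro sum.mono_neutral_left) (auto simp: coeff_eq_0)
  ultimately show ?thesis by (simp add: innerR_def)
qed

lemma innerR_add_left: "innerR c (f + g) h = innerR c f h + innerR c g h"
proof -
  let ?N = "max (degree f) (degree g)"
  have "degree (f + g) \<le> ?N" by (rule degree_add_le_max)
  then show ?thesis
    by (simp add: innerR_bounded[where N = ?N and M = "degree h"] sum.distrib[symmetric]
        algebra_simps)
qed

lemma innerR_add_right: "innerR c f (g + h) = innerR c f g + innerR c f h"
proof -
  let ?M = "max (degree g) (degree h)"
  have "degree (g + h) \<le> ?M" by (rule degree_add_le_max)
  then show ?thesis
    by (simp add: innerR_bounded[where N = "degree f" and M = ?M] sum.distrib[symmetric]
        qcnj_add algebra_simps)
qed

lemma innerR_0_left [simp]: "innerR c 0 g = 0"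
  and innerR_0_right [simp]: "innerR c f 0 = 0"
  by (simp_all add: innerR_def)

lemma innerR_diff_left: "innerR c (f - g) h = innerR c f h - innerR c g h"
  using innerR_add_left[of c "f - g" g h] by simp

lemma innerR_diff_right: "innerR c f (g - h) = innerR c f g - innerR c f h"
  using innerR_add_right[of c f "g - h" h] by simp

lemma innerR_sum_left: "innerR c (sum f A) h = (\<Sum>i\<in>A. innerR c (f i) h)"
  by (induction A rule: infinite_finite_induct) (simp_all add: innerR_add_left)

lemma innerR_sum_right: "innerR c f (sum h A) = (\<Sum>i\<in>A. innerR c f (h i))"
  by (induction A rule: infinite_finite_induct) (simp_all add: innerR_add_right)

lemma innerR_rscale_left: "innerR c (rscale f q) g = innerR c f g * q"
  by (simp add: innerR_bounded[where N = "degree f" and M = "degree g"] degree_rscale_le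
      sum_distrib_right mult.assoc)

lemma innerR_rscale_right: "innerR c f (rscale g q) = qcnj q * innerR c f g"
  by (simp add: innerR_bounded[where N = "degree f" and M = "degree g"] degree_rscale_le
      sum_distrib_left qcnj_mult mult.assoc)

lemma innerR_monom:
  assumes "degree f \<le> N"
  shows "innerR c f (monom 1 l) = (\<Sum>k\<le>N. c (int k - int l) * coeff f k)"
proof -
  have "(\<Sum>i\<le>l. qcnj (if l = i then 1 else 0) * c (int k - int i) * coeff f k) =
      c (int k - int l) * coeff f k" for k
    by (subst sum.mono_neutral_right[where S = "{l}"]) auto
  then show ?thesis
    using assms by (simp add: innerR_bounded[where N = N and M = l] degree_monom_eq)
qed

lemma innerR_expand_right:
  assumes "degree g \<le> M"
  shows "innerR c f g = (\<Sum>l\<le>M. qcnj (coeff g l) * innerR c f (monom 1 l))"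
  using assms
  by (simp add: innerR_monom[OF order_refl] innerR_bounded[OF order_refl assms]
      sum.swap[of _ "{..M}"] sum_distrib_left mult.assoc)

text \<open>The main tool for orthogonality: if only one monomial contributes to the pairing with
  \<open>g\<close> and its coefficient is nonzero, orthogonality to \<open>g\<close> amounts to
  orthogonality to that monomial.\<close>

lemma innerR_expand_single:
  assumes "degree g \<le> M" "j \<le> M"
    and "\<And>k. k \<le> M \<Longrightarrow> k \<noteq> j \<Longrightarrow> coeff g k = 0 \<or> innerR c f (monom 1 k) = 0"
  shows "innerR c f g = qcnj (coeff g j) * innerR c f (monom 1 j)"
proof -
  have "innerR c f g = (\<Sum>l\<in>{j}. qcnj (coeff g l) * innerR c f (monom 1 l))"
    unfolding innerR_expand_right[OF assms(1)]
    using assms by (intro sum.mono_neutral_right) auto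
  then show ?thesis by simp
qed

lemma innerR_eq_0:
  assumes "degree g \<le> M"
    and "\<And>k. k \<le> M \<Longrightarrow> coeff g k = 0 \<or> innerR c f (monom 1 k) = 0"
  shows "innerR c f g = 0"
  unfolding innerR_expand_right[OF assms(1)] using assms(2) by (intro sum.neutral) auto

text \<open>The Toeplitz structure: the weight depends only on \<open>k - l\<close>, so
  multiplication by the variable is an isometry.\<close>

lemma innerR_shift: "innerR c (pCons 0 f) (pCons 0 g) = innerR c f g"
proof -
  have "innerR c (pCons 0 f) (pCons 0 g) =
     (\<Sum>k\<le>Suc (degree f). \<Sum>l\<le>Suc (degree g).
        qcnj (coeff (pCons 0 g) l) * c (int k - int l) * coeff (pCons 0 f) k)"
    by (intro innerR_bounded) (rule degree_pCons_le)+
  also have "\<dots> = innerR c f g"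
    by (simp add: sum.atMost_Suc_shift innerR_def del: sum.atMost_Suc)
  finally show ?thesis .
qed

lemma sum_sum_reflect:
  fixes n :: nat
  shows "(\<Sum>k\<le>n. \<Sum>l\<le>n. h k l) = (\<Sum>k\<le>n. \<Sum>l\<le>n. h (n - k) (n - l))"
proof -
  have reflect: "(\<Sum>k\<le>n. e k) = (\<Sum>k\<le>n. e (n - k))" for e :: "nat \<Rightarrow> 'a"
    by (rule sum.reindex_bij_witness[where i = "\<lambda>k. n - k" and j = "\<lambda>k. n - k"]) auto
  show ?thesis by (subst reflect, subst (2) reflect) (rule refl)
qed

text \<open>Replacing both indices by their difference from \<open>n\<close> changes the sign of
  \<open>k - l\<close>. The reflection is stated through coefficients because
  \<open>reflect_poly\<close> reverses at the actual degree, which for a monomial may differ from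
  \<open>n\<close>.\<close>

lemma innerR_reflect:
  assumes "degree f \<le> n" "degree g \<le> n" "degree f' \<le> n" "degree g' \<le> n"
    and "\<And>k. k \<le> n \<Longrightarrow> coeff f' k = coeff f (n - k)"
    and "\<And>k. k \<le> n \<Longrightarrow> coeff g' k = coeff g (n - k)"
  shows "innerR c f' g' = innerR (\<lambda>m. c (- m)) f g"
proof -
  have "innerR c f' g' =
      (\<Sum>k\<le>n. \<Sum>l\<le>n. qcnj (coeff g (n - l)) * c (int k - int l) * coeff f (n - k))"
    using assms by (simp add: innerR_bounded[where N = n and M = n])
  also have "\<dots> = (\<Sum>k\<le>n. \<Sum>l\<le>n. qcnj (coeff g l) * c (int l - int k) * coeff f k)"
    by (subst sum_sum_reflect) (intro sum.cong refl, simp add: of_nat_diff)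
  also have "\<dots> = innerR (\<lambda>m. c (- m)) f g"
    using assms by (simp add: innerR_bounded[where N = n and M = n])
  finally show ?thesis .
qed


section \<open>Evaluation\<close>

lemma eval_coeffs_right_bounded:
  assumes "degree f \<le> N"
  shows "eval_coeffs_right f p = (\<Sum>k\<le>N. p ^ k * coeff f k)"
  unfolding eval_coeffs_right_def
  using assms by (intro sum.mono_neutral_left) (auto simp: coeff_eq_0)

lemma eval_coeffs_right_diff:
  "eval_coeffs_right (f - g) p = eval_coeffs_right f p - eval_coeffs_right g p"
proof -
  let ?N = "max (degree f) (degree g)"
  have "degree (f - g) \<le> ?N" by (rule degree_diff_le_max)
  then show ?thesis
    by (simp add: eval_coeffs_right_bounded[where N = ?N] sum_subtractf[symmetric] algebra_simps)
qed

lemma eval_coeffs_right_rscale: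
  "eval_coeffs_right (rscale f q) p = eval_coeffs_right f p * q"
  by (simp add: eval_coeffs_right_bounded[where N = "degree f"] degree_rscale_le
      sum_distrib_right mult.assoc)

lemma eval_coeffs_right_shift:
  "eval_coeffs_right (pCons 0 f) p = p * eval_coeffs_right f p"
proof -
  have "eval_coeffs_right (pCons 0 f) p = (\<Sum>k\<le>Suc (degree f). p ^ k * coeff (pCons 0 f) k)"
    by (intro eval_coeffs_right_bounded) (rule degree_pCons_le)
  also have "\<dots> = p * eval_coeffs_right f p"
    by (simp add: sum.atMost_Suc_shift eval_coeffs_right_def sum_distrib_left mult.assoc
        del: sum.atMost_Suc)
  finally show ?thesis .
qed

lemma degree_map_poly_qcnj [simp]: "degree (map_poly qcnj f) = degree f"
  by (rule degree_map_poly) simp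

text \<open>Conjugation reverses products, so it carries left coefficients to the right and the
  point to its conjugate, without changing the modulus.\<close>

lemma norm_eval_coeffs_left_qcnj:
  "norm (eval_coeffs_left (map_poly qcnj f) p) = norm (eval_coeffs_right f (qcnj p))"
proof -
  have "eval_coeffs_left (map_poly qcnj f) p = qcnj (eval_coeffs_right f (qcnj p))"
    by (simp add: eval_coeffs_left_def eval_coeffs_right_def qcnj_sum qcnj_mult qcnj_power
        coeff_map_poly)
  then show ?thesis by simp
qed


section \<open>Positive definiteness\<close>

text \<open>Listing the entries of the test vector backwards turns the form of the reversed sequence
  into that of \<open>c\<close>.\<close>

lemma nontrivial_reverse:
  assumes "nontrivial_positive_definite_seq c"
  shows "nontrivial_positive_definite_seq (\<lambda>m. c (- m))"
proof -
  have form: "toeplitz_form (\<lambda>m. c (- m)) n \<xi> = toeplitz_form c n (\<lambda>k. \<xi> (n - k))" for n \<xi>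
    unfolding toeplitz_form_def toeplitz_def
    by (subst sum_sum_reflect) (intro sum.cong refl, simp add: of_nat_diff)
  have "\<exists>r>0. toeplitz_form (\<lambda>m. c (- m)) n \<xi> = of_real r" if "\<exists>k\<le>n. \<xi> k \<noteq> 0" for n \<xi>
  proof -
    from that have "\<exists>k\<le>n. \<xi> (n - k) \<noteq> 0"
      by (metis diff_diff_cancel diff_le_self)
    with assms show ?thesis
      unfolding nontrivial_positive_definite_seq_def form by auto
  qed
  moreover have "\<exists>r\<ge>0. toeplitz_form (\<lambda>m. c (- m)) n \<xi> = of_real r" for n \<xi>
    using assms
    unfolding nontrivial_positive_definite_seq_def positive_definite_seq_def form by auto
  ultimately show ?thesis
    unfolding nontrivial_positive_definite_seq_def positive_definite_seq_def by simp
qed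

text \<open>Polarization: the form takes only real values, and vectors supported on the two indices
  0 and \<open>j\<close> already force the symmetry.\<close>

lemma positive_definite_seq_uminus:
  assumes "positive_definite_seq c"
  shows "c (- m) = qcnj (c m)"
proof -
  have real: "\<exists>r. toeplitz_form c n \<xi> = of_real r" for n \<xi>
    using assms unfolding positive_definite_seq_def by blast
  have nat: "c (- int j) = qcnj (c (int j))" for j
  proof -
    obtain r0 where r0: "c 0 = of_real r0"
      using real[of 0 "\<lambda>_. 1"] by (auto simp: toeplitz_form_def toeplitz_def)
    show ?thesis
    proof (cases "j = 0")
      case True
      with r0 show ?thesis by simp
    next
      case False
      have form: "toeplitz_form c j (\<lambda>k. if k = 0 then 1 else if k = j then q else 0) =
          c 0 + c (int j) * q + qcnj q * c (- int j) + qcnj q * c 0 * q" (is "?l = ?r") for q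
      proof -
        let ?\<xi> = "\<lambda>k. if k = 0 then 1 else if k = j then q else 0"
        have row: "(\<Sum>l\<le>j. x * toeplitz c k l * ?\<xi> l) =
            x * (toeplitz c k 0 + toeplitz c k j * q)" for k x
        proof -
          have "(\<Sum>l\<le>j. x * toeplitz c k l * ?\<xi> l) =
              (\<Sum>l\<in>{0,j}. x * toeplitz c k l * ?\<xi> l)"
            by (intro sum.mono_neutral_right) auto
          with False show ?thesis by (simp add: algebra_simps)
        qed
        have "?l = (\<Sum>k\<le>j. qcnj (?\<xi> k) * (toeplitz c k 0 + toeplitz c k j * q))"
          unfolding toeplitz_form_def row ..
        also have "\<dots> = (\<Sum>k\<in>{0,j}. qcnj (?\<xi> k) * (toeplitz c k 0 + toeplitz c k j * q))"
          by (intro sum.mono_neutral_right) auto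
        also have "\<dots> = ?r"
          using False by (simp add: toeplitz_def algebra_simps)
        finally show ?thesis .
      qed
      \<comment> \<open>With \<open>q = 1\<close> the imaginary parts of \<open>c (int j)\<close>
        and \<open>c (- int j)\<close> are seen to be opposite; \<open>q = i\<close> below gives the
        equality of their real parts.\<close>
      obtain r1 where r1: "c 0 + c (int j) * 1 + qcnj 1 * c (- int j) + qcnj 1 * c 0 * 1
          = of_real r1"
        using real unfolding form[symmetric] by blast
      obtain r2 where r2: "c 0 + c (int j) * Quat 0 1 0 0 + qcnj (Quat 0 1 0 0) * c (- int j)
          + qcnj (Quat 0 1 0 0) * c 0 * Quat 0 1 0 0 = of_real r2"
        using real unfolding form[symmetric] by blast
      from r1 r2 r0 show ?thesis
        by (auto simp: quat_eq_iff of_real_def)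
    qed
  qed
  show ?thesis
  proof (cases "m \<ge> 0")
    case True
    with nat[of "nat m"] show ?thesis by simp
  next
    case False
    with nat[of "nat (- m)"] show ?thesis by simp
  qed
qed

lemma innerR_self_toeplitz_form: "innerR c f f = toeplitz_form c (degree f) (coeff f)"
  unfolding innerR_def toeplitz_form_def toeplitz_def by (rule sum.swap)

context
  fixes c :: "int \<Rightarrow> quat"
  assumes nontriv: "nontrivial_positive_definite_seq c"
begin

lemma innerR_self_pos:
  assumes "f \<noteq> 0"
  obtains r where "r > 0" "innerR c f f = of_real r"
proof -
  have "\<exists>k\<le>degree f. coeff f k \<noteq> 0"
    using assms by (intro exI[of _ "degree f"]) simp
  then show ?thesis
    using nontriv that
    unfolding nontrivial_positive_definite_seq_def innerR_self_toeplitz_form by blast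
qed

lemma innerR_self_real: "innerR c f f = of_real (qRe (innerR c f f))"
proof (cases "f = 0")
  case False
  then show ?thesis using innerR_self_pos[of f] by (metis qRe_of_real)
qed simp

lemma innerR_self_qRe_pos: "f \<noteq> 0 \<Longrightarrow> qRe (innerR c f f) > 0"
  using innerR_self_pos[of f] by (metis qRe_of_real)

lemma innerR_qcnj: "innerR c g f = qcnj (innerR c f g)"
proof -
  have "qcnj (c (int l - int k)) = c (int k - int l)" for k l :: nat
    using positive_definite_seq_uminus[of c "int l - int k"] nontriv
    by (simp add: nontrivial_positive_definite_seq_def)
  then show ?thesis
    unfolding innerR_def
    by (subst sum.swap) (simp add: qcnj_sum qcnj_mult mult.assoc)
qed

text \<open>The polynomials of degree at most $m$ that are orthogonal to all $p^k$ with $k \le m$,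
  $k \ne j$, form a one-dimensional space; the case $j = m$ is that of $\psi_m^R$ and the case
  $j = 0$ that of $\psi_m^{L,\#}$.\<close>

lemma norm_eval_orthogonal_unique:
  assumes deg: "degree f \<le> m" "degree g \<le> m" and j: "j \<le> m"
    and f: "\<And>k. k \<le> m \<Longrightarrow> k \<noteq> j \<Longrightarrow> innerR c f (monom 1 k) = 0"
    and g: "\<And>k. k \<le> m \<Longrightarrow> k \<noteq> j \<Longrightarrow> innerR c g (monom 1 k) = 0"
    and unit: "innerR c g g = 1"
  shows "(norm (eval_coeffs_right f p))\<^sup>2 =
    (norm (eval_coeffs_right g p))\<^sup>2 * qRe (innerR c f f)"
proof -
  \<comment> \<open>All terms but the one at \<open>j\<close> vanish, so unit norm excludes a zero
    coefficient there.\<close>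
  have "innerR c g g = qcnj (coeff g j) * innerR c g (monom 1 j)"
    using deg j g by (intro innerR_expand_single) auto
  with unit have gj: "coeff g j \<noteq> 0" by auto
  \<comment> \<open>Chosen so that \<open>f\<close> and \<open>rscale g q\<close> share the
    coefficient at \<open>j\<close>. The difference \<open>h\<close> is then orthogonal to every
    monomial it contains, hence to itself, and definiteness gives \<open>h = 0\<close>.\<close>
  define q where "q = inverse (coeff g j) * coeff f j"
  define h where "h = f - rscale g q"
  have "coeff h j = 0"
    using gj by (simp add: h_def q_def mult.assoc[symmetric])
  moreover have "innerR c h (monom 1 k) = 0" if "k \<le> m" "k \<noteq> j" for k
    using that f g by (simp add: h_def innerR_diff_left innerR_rscale_left)
  moreover have "degree h \<le> m"
    unfolding h_def using deg by (meson degree_diff_le degree_rscale_le order_trans)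
  ultimately have "innerR c h h = 0"
    by (intro innerR_eq_0[where M = m]) auto
  then have "h = 0" using innerR_self_qRe_pos[of h] by force
  then have f_eq: "f = rscale g q" by (simp add: h_def)
  have "innerR c f f = of_real ((norm q)\<^sup>2)"
    unfolding f_eq innerR_rscale_left innerR_rscale_right unit by (simp add: qcnj_mult_self)
  then have "qRe (innerR c f f) = (norm q)\<^sup>2" by (metis qRe_of_real)
  then show ?thesis
    by (simp add: f_eq eval_coeffs_right_rscale norm_mult power_mult_distrib)
qed


section \<open>Orthonormality\<close>

text \<open>One Gram-Schmidt step, with the real normalizing factor written as a right scalar so
  that the rules for \<open>rscale\<close> cover it as well.\<close>

lemma orthonormalR_decompose:
  obtains w s where "orthonormalR c n = rscale w (of_real (inverse s))"
    and "s = sqrt (qRe (innerR c w w))"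
    and "w = monom 1 n -
      (\<Sum>k<n. rscale (orthonormalR c k) (innerR c (monom 1 n) (orthonormalR c k)))"
proof -
  have eq: "a /\<^sub>R s = a * of_real (inverse s)" for a :: quat and s
    by (simp add: quat_eq_iff of_real_def mult.commute)
  show ?thesis
    by (rule that[OF _ refl refl], subst orthonormalR.simps)
       (simp only: normalizeR_def eq rscale_def)
qed

text \<open>The three properties are proved in one strong induction: the degrees of the earlier
  polynomials make \<open>w\<close> monic, hence of positive norm, and their orthonormality makes
  the subtracted projections remove every component.\<close>

lemma orthonormalR_props:
  "degree (orthonormalR c n) = n \<and>
   innerR c (orthonormalR c n) (orthonormalR c n) = 1 \<and>
   (\<forall>k<n. innerR c (orthonormalR c n) (orthonormalR c k) = 0)"
proof (induction n rule: less_induct)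
  case (less n)
  let ?P = "orthonormalR c"
  obtain w s where ws: "?P n = rscale w (of_real (inverse s))"
    "s = sqrt (qRe (innerR c w w))"
    "w = monom 1 n - (\<Sum>k<n. rscale (?P k) (innerR c (monom 1 n) (?P k)))"
    by (rule orthonormalR_decompose)
  \<comment> \<open>The induction hypothesis has the larger index in the first argument; Hermitian
    symmetry supplies the other order.\<close>
  have orth: "innerR c (?P i) (?P k) = (if i = k then 1 else 0)" if "i < n" "k < n" for i k
    using less that innerR_qcnj[of "?P i" "?P k"] by (cases i k rule: linorder_cases) auto
  have coeff_w: "coeff w m = (if m = n then 1 else 0)" if "m \<ge> n" for m
  proof -
    have "coeff (?P k) m = 0" if "k < n" for k
      using less[OF that] that \<open>m \<ge> n\<close> by (intro coeff_eq_0) simp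
    then show ?thesis by (simp add: ws(3) coeff_sum)
  qed
  have w0: "w \<noteq> 0" using coeff_w[of n] by auto
  from innerR_self_qRe_pos[OF this] have s: "s > 0" by (simp add: ws(2))
  have "degree (?P n) \<le> n"
    by (rule degree_le) (simp add: ws(1) coeff_w)
  moreover have "n \<le> degree (?P n)"
    using s by (intro le_degree) (simp add: ws(1) coeff_w)
  moreover have "innerR c (?P n) (?P n) = 1"
  proof -
    have "innerR c w w = of_real (s * s)"
      using innerR_self_real[of w] innerR_self_qRe_pos[OF w0] ws(2) by simp
    then have "innerR c (?P n) (?P n) = of_real (inverse s * (s * s) * inverse s)"
      unfolding ws(1) innerR_rscale_left innerR_rscale_right
      by (simp only: qcnj_of_real of_real_mult mult.assoc)
    also have "inverse s * (s * s) * inverse s = 1" using s by (simp add: field_simps)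
    finally show ?thesis by simp
  qed
  moreover have "innerR c (?P n) (?P k) = 0" if "k < n" for k
  proof -
    have "(\<Sum>i<n. innerR c (?P i) (?P k) * innerR c (monom 1 n) (?P i)) =
        innerR c (monom 1 n) (?P k)"
      using that by (subst sum.mono_neutral_right[where S = "{k}"]) (auto simp: orth)
    then have "innerR c w (?P k) = 0"
      by (simp add: ws(3) innerR_diff_left innerR_sum_left innerR_rscale_left)
    then show ?thesis by (simp add: ws(1) innerR_rscale_left)
  qed
  ultimately show ?case by simp
qed

lemma degree_orthonormalR [simp]: "degree (orthonormalR c n) = n"
  and innerR_orthonormalR_self: "innerR c (orthonormalR c n) (orthonormalR c n) = 1"
  using orthonormalR_props by blast+

lemma coeff_orthonormalR_nonzero: "coeff (orthonormalR c n) n \<noteq> 0"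
proof -
  have "orthonormalR c n \<noteq> 0"
    using innerR_orthonormalR_self[of n] by auto
  then show ?thesis
    using leading_coeff_0_iff[of "orthonormalR c n"] by simp
qed

text \<open>Solving Gram-Schmidt step \<open>k\<close> for the monomial puts it in the right span of
  the orthonormal polynomials of index at most \<open>k\<close>.\<close>

lemma innerR_orthonormalR_monom:
  assumes "k < n"
  shows "innerR c (orthonormalR c n) (monom 1 k) = 0"
proof -
  let ?P = "orthonormalR c"
  obtain w s where ws: "?P k = rscale w (of_real (inverse s))"
    "s = sqrt (qRe (innerR c w w))"
    "w = monom 1 k - (\<Sum>i<k. rscale (?P i) (innerR c (monom 1 k) (?P i)))"
    by (rule orthonormalR_decompose)
  \<comment> \<open>Since \<open>inverse 0 = 0\<close>, a zero \<open>s\<close> would make the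
    normalized polynomial zero, against its unit norm.\<close>
  have "s \<noteq> 0"
    using innerR_orthonormalR_self[of k]
    by (auto simp: ws(1) innerR_rscale_left)
  then have "w = rscale (?P k) (of_real s)"
    by (simp add: ws(1) rscale_rscale flip: of_real_mult del: of_real_inverse)
  then have "monom 1 k = rscale (?P k) (of_real s) +
      (\<Sum>i<k. rscale (?P i) (innerR c (monom 1 k) (?P i)))"
    using ws(3) by (simp add: algebra_simps)
  moreover have "innerR c (?P n) (rscale (?P k) (of_real s) +
      (\<Sum>i<k. rscale (?P i) (innerR c (monom 1 k) (?P i)))) = 0"
    using assms orthonormalR_props[of n]
    by (simp add: innerR_add_right innerR_sum_right innerR_rscale_right)
  ultimately show ?thesis by simp
qed

end


section \<open>The Szeg\H{o} recursion\<close>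

text \<open>As \<open>reflectedR c n\<close> has the coefficients of $\psi_n^{L,\#}$, both families of
  polynomials in the recursion lie in $\mathbb{H}[p]^L$.\<close>

definition reflectedR :: "(int \<Rightarrow> quat) \<Rightarrow> nat \<Rightarrow> quat poly" where
  "reflectedR c n = reflect_poly (orthonormalR (\<lambda>m. c (- m)) n)"

context
  fixes c :: "int \<Rightarrow> quat"
  assumes nontriv: "nontrivial_positive_definite_seq c"
begin

lemma degree_reflectedR_le: "degree (reflectedR c n) \<le> n"
  unfolding reflectedR_def
  using degree_reflect_poly_le[of "orthonormalR (\<lambda>m. c (- m)) n"]
  by (simp add: degree_orthonormalR[OF nontrivial_reverse[OF nontriv]])

lemma coeff_reflectedR:
  "k \<le> n \<Longrightarrow> coeff (reflectedR c n) k = coeff (orthonormalR (\<lambda>m. c (- m)) n) (n - k)"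
  by (simp add: reflectedR_def coeff_reflect_poly
      degree_orthonormalR[OF nontrivial_reverse[OF nontriv]])

lemma coeff_reflectedR_0_nonzero: "coeff (reflectedR c n) 0 \<noteq> 0"
  using coeff_orthonormalR_nonzero[OF nontrivial_reverse[OF nontriv]]
  by (simp add: coeff_reflectedR)

lemma innerR_reflectedR_self: "innerR c (reflectedR c n) (reflectedR c n) = 1"
  using innerR_reflect[where f' = "reflectedR c n" and g' = "reflectedR c n" and n = n and c = c
      and f = "orthonormalR (\<lambda>m. c (- m)) n" and g = "orthonormalR (\<lambda>m. c (- m)) n"]
    innerR_orthonormalR_self[OF nontrivial_reverse[OF nontriv]]
  by (simp add: degree_reflectedR_le coeff_reflectedR
      degree_orthonormalR[OF nontrivial_reverse[OF nontriv]])

text \<open>Reversal at \<open>n\<close> sends exponent \<open>k\<close> to \<open>n - k\<close>,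
  which is below \<open>n\<close> because \<open>k\<close> is positive; the constant monomial is the
  one left out.\<close>

lemma innerR_reflectedR_monom:
  assumes "0 < k" "k \<le> n"
  shows "innerR c (reflectedR c n) (monom 1 k) = 0"
proof -
  have "innerR c (reflectedR c n) (monom 1 k) =
      innerR (\<lambda>m. c (- m)) (orthonormalR (\<lambda>m. c (- m)) n) (monom 1 (n - k))"
    using assms
    by (intro innerR_reflect[where n = n])
      (auto simp: degree_reflectedR_le coeff_reflectedR degree_monom_eq
        degree_orthonormalR[OF nontrivial_reverse[OF nontriv]])
  then show ?thesis
    using assms by (simp add: innerR_orthonormalR_monom[OF nontrivial_reverse[OF nontriv]])
qed

lemma szego_step:
  "(norm (eval_coeffs_right (reflectedR c (Suc n)) p))\<^sup>2
    - (norm (eval_coeffs_right (orthonormalR c (Suc n)) p))\<^sup>2 =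
   (norm (eval_coeffs_right (reflectedR c n) p))\<^sup>2
    - (norm p)\<^sup>2 * (norm (eval_coeffs_right (orthonormalR c n) p))\<^sup>2"
proof -
  define u where "u = pCons 0 (orthonormalR c n)"
  define v where "v = reflectedR c n"
  define a where "a = innerR c u v"
  define f where "f = u - rscale v a"
  define g where "g = v - rscale u (qcnj a)"
  have deg_u: "degree u \<le> Suc n"
    unfolding u_def using degree_pCons_le[of 0 "orthonormalR c n"]
    by (simp add: degree_orthonormalR[OF nontriv])
  have deg_v: "degree v \<le> n" unfolding v_def by (rule degree_reflectedR_le)
  have deg_f: "degree f \<le> Suc n" and deg_g: "degree g \<le> Suc n"
    unfolding f_def g_def using deg_u deg_v degree_rscale_le[of u "qcnj a"] degree_rscale_le[of v a]
    by (auto intro!: degree_diff_le)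
  have uu: "innerR c u u = 1"
    by (simp add: u_def innerR_shift innerR_orthonormalR_self[OF nontriv])
  have vv: "innerR c v v = 1" by (simp add: v_def innerR_reflectedR_self)
  have vu: "innerR c v u = qcnj a"
    unfolding a_def by (rule innerR_qcnj[OF nontriv])
  \<comment> \<open>The shift isometry lowers the exponent by one, to a value below
    \<open>n\<close>.\<close>
  have u_monom: "innerR c u (monom 1 k) = 0" if "0 < k" "k \<le> n" for k
  proof -
    from that obtain i where "k = Suc i" by (cases k) auto
    with that show ?thesis
      by (simp add: u_def monom_Suc innerR_shift innerR_orthonormalR_monom[OF nontriv])
  qed
  have v_monom: "innerR c v (monom 1 k) = 0" if "0 < k" "k \<le> n" for k
    using that by (simp add: v_def innerR_reflectedR_monom)
  have fv: "innerR c f v = 0" and gu: "innerR c g u = 0"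
    by (simp_all add: f_def g_def innerR_diff_left innerR_rscale_left uu vv vu a_def)
  have f_monom': "innerR c f (monom 1 k) = 0" and g_monom': "innerR c g (monom 1 k) = 0"
    if "0 < k" "k \<le> n" for k
    using that by (simp_all add: f_def g_def innerR_diff_left innerR_rscale_left u_monom v_monom)
  \<comment> \<open>Exponent 0 remains. It follows from \<open>f\<close> being orthogonal to
    \<open>v\<close>, whose constant coefficient is nonzero and whose other monomials are already
    orthogonal to \<open>f\<close>.\<close>
  have f_monom: "innerR c f (monom 1 k) = 0" if "k \<le> n" for k
  proof (cases "k = 0")
    case True
    have "innerR c f v = qcnj (coeff v 0) * innerR c f (monom 1 0)"
      using f_monom' deg_v by (intro innerR_expand_single[where M = n]) auto
    moreover have "coeff v 0 \<noteq> 0" by (simp add: v_def coeff_reflectedR_0_nonzero)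
    ultimately show ?thesis using fv True by auto
  qed (use that f_monom' in auto)
  have u_top: "coeff u (Suc n) \<noteq> 0"
    by (simp add: u_def coeff_orthonormalR_nonzero[OF nontriv])
  \<comment> \<open>The dual argument at exponent \<open>Suc n\<close>: \<open>u\<close> has no
    constant term and a nonzero top coefficient, and \<open>g\<close> is orthogonal to
    \<open>u\<close>.\<close>
  have g_monom: "innerR c g (monom 1 k) = 0" if "0 < k" "k \<le> Suc n" for k
  proof (cases "k = Suc n")
    case True
    have "coeff u i = 0 \<or> innerR c g (monom 1 i) = 0" if "i \<le> Suc n" "i \<noteq> Suc n" for i
      using that g_monom'[of i] by (cases "i = 0") (auto simp: u_def)
    then have "innerR c g u = qcnj (coeff u (Suc n)) * innerR c g (monom 1 (Suc n))"
      using deg_u by (intro innerR_expand_single[where M = "Suc n"]) auto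
    with u_top gu True show ?thesis by auto
  qed (use that g_monom' in auto)
  have "innerR c f f = of_real (1 - (norm a)\<^sup>2)"
  proof -
    have "innerR c f f = innerR c f u"
      using fv by (simp add: f_def[THEN arg_cong[where f = "innerR c f"]] innerR_diff_right
          innerR_rscale_right)
    then show ?thesis
      by (simp add: f_def innerR_diff_left innerR_rscale_left uu vu qcnj_mult_self)
  qed
  then have ff: "qRe (innerR c f f) = 1 - (norm a)\<^sup>2" by (metis qRe_of_real)
  have "innerR c g g = of_real (1 - (norm a)\<^sup>2)"
  proof -
    have "innerR c g g = innerR c g v"
      using gu by (simp add: g_def[THEN arg_cong[where f = "innerR c g"]] innerR_diff_right
          innerR_rscale_right)
    then show ?thesis
      by (simp add: g_def innerR_diff_left innerR_rscale_left vv a_def[symmetric] mult_qcnj)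
  qed
  then have gg: "qRe (innerR c g g) = 1 - (norm a)\<^sup>2" by (metis qRe_of_real)
  \<comment> \<open>Only \<open>u\<close> reaches degree \<open>Suc n\<close>, so \<open>f\<close>
    is nonzero and \<open>a\<close> has modulus below 1; this permits cancelling the common factor
    at the end.\<close>
  have "coeff f (Suc n) \<noteq> 0"
    using u_top deg_v by (simp add: f_def coeff_eq_0)
  then have "f \<noteq> 0" by auto
  from innerR_self_qRe_pos[OF nontriv this] have pos: "1 - (norm a)\<^sup>2 > 0"
    by (simp add: ff)
  let ?u = "p * eval_coeffs_right (orthonormalR c n) p"
  let ?v = "eval_coeffs_right (reflectedR c n) p"
  have "(norm (eval_coeffs_right f p))\<^sup>2 =
      (norm (eval_coeffs_right (orthonormalR c (Suc n)) p))\<^sup>2 * qRe (innerR c f f)"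
    using deg_f f_monom
    by (intro norm_eval_orthogonal_unique[OF nontriv, where m = "Suc n" and j = "Suc n"])
      (auto simp: degree_orthonormalR[OF nontriv] innerR_orthonormalR_monom[OF nontriv]
        innerR_orthonormalR_self[OF nontriv])
  moreover have "(norm (eval_coeffs_right g p))\<^sup>2 =
      (norm (eval_coeffs_right (reflectedR c (Suc n)) p))\<^sup>2 * qRe (innerR c g g)"
    using deg_g g_monom
    by (intro norm_eval_orthogonal_unique[OF nontriv, where m = "Suc n" and j = 0])
      (auto simp: degree_reflectedR_le innerR_reflectedR_monom innerR_reflectedR_self)
  moreover have "eval_coeffs_right f p = ?u - ?v * a"
    "eval_coeffs_right g p = ?v - ?u * qcnj a"
    by (simp_all add: f_def g_def u_def v_def eval_coeffs_right_diff eval_coeffs_right_rscale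
        eval_coeffs_right_shift)
  ultimately have "(1 - (norm a)\<^sup>2) *
      ((norm (eval_coeffs_right (reflectedR c (Suc n)) p))\<^sup>2
       - (norm (eval_coeffs_right (orthonormalR c (Suc n)) p))\<^sup>2) =
      (1 - (norm a)\<^sup>2) * ((norm ?v)\<^sup>2 - (norm ?u)\<^sup>2)"
    using norm_diff_mult_diff[of ?v ?u a] by (simp add: ff gg algebra_simps)
  with pos show ?thesis by (simp add: norm_mult power_mult_distrib)
qed

text \<open>At \<open>n = 0\<close> both polynomials are constants of unit norm, so uniqueness gives
  equal moduli; afterwards \<open>szego_step\<close> makes the sum telescope.\<close>

lemma christoffel_darboux_right:
  "(1 - (norm p)\<^sup>2) * (\<Sum>l\<le>n. (norm (eval_coeffs_right (orthonormalR c l) p))\<^sup>2) =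
   (norm (eval_coeffs_right (reflectedR c n) p))\<^sup>2
    - (norm p)\<^sup>2 * (norm (eval_coeffs_right (orthonormalR c n) p))\<^sup>2"
proof (induction n)
  case 0
  have "(norm (eval_coeffs_right (reflectedR c 0) p))\<^sup>2 =
      (norm (eval_coeffs_right (orthonormalR c 0) p))\<^sup>2
        * qRe (innerR c (reflectedR c 0) (reflectedR c 0))"
    using degree_reflectedR_le[of 0]
    by (intro norm_eval_orthogonal_unique[OF nontriv, where m = 0 and j = 0])
      (auto simp: degree_orthonormalR[OF nontriv] innerR_orthonormalR_self[OF nontriv])
  then show ?case by (simp add: innerR_reflectedR_self algebra_simps)
next
  case (Suc n)
  then show ?case using szego_step[of n p] by (simp add: algebra_simps)
qed

end


section \<open>Left and right orthonormal polynomials\<close>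

text \<open>Conjugating a summand reverses its three factors, and the symmetry of \<open>c\<close>
  turns the conjugated middle factor into an entry at the opposite index.\<close>

lemma innerL_map_qcnj:
  assumes "positive_definite_seq c"
  shows "innerL c (map_poly qcnj f) (map_poly qcnj g) = qcnj (innerR (\<lambda>m. c (- m)) f g)"
proof -
  have "qcnj (c (- (int k - int l))) = c (int k - int l)" for k l
    by (simp only: positive_definite_seq_uminus[OF assms] qcnj_qcnj)
  then show ?thesis
    by (simp add: innerL_def innerR_def qcnj_sum qcnj_mult coeff_map_poly mult.assoc)
qed

text \<open>Each Gram-Schmidt step commutes with conjugation of coefficients, which exchanges left
  and right projection factors.\<close>

lemma orthonormalL_eq:
  assumes "positive_definite_seq c"
  shows "orthonormalL c n = map_poly qcnj (orthonormalR (\<lambda>m. c (- m)) n)"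
proof (induction n rule: less_induct)
  case (less n)
  let ?d = "\<lambda>m. c (- m)"
  let ?P = "orthonormalR ?d"
  let ?w = "monom 1 n - (\<Sum>k<n. map_poly (\<lambda>a. a * innerR ?d (monom 1 n) (?P k)) (?P k))"
  have coefficient: "innerL c (monom 1 n) (map_poly qcnj (?P k)) = qcnj (innerR ?d (monom 1 n) (?P k))"
    for k
    using innerL_map_qcnj[OF assms, of "monom 1 n" "?P k"] by (simp add: map_poly_monom)
  have "(\<Sum>k<n. map_poly (\<lambda>a. innerL c (monom 1 n) (orthonormalL c k) * a) (orthonormalL c k)) =
      (\<Sum>k<n. map_poly (\<lambda>a. qcnj (innerR ?d (monom 1 n) (?P k)) * a) (map_poly qcnj (?P k)))"
    by (intro sum.cong refl) (simp add: coefficient less)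
  then have "orthonormalL c n = normalizeL c (monom 1 n -
      (\<Sum>k<n. map_poly (\<lambda>a. qcnj (innerR ?d (monom 1 n) (?P k)) * a) (map_poly qcnj (?P k))))"
    by (simp only: orthonormalL.simps[of c n])
  also have "monom 1 n -
      (\<Sum>k<n. map_poly (\<lambda>a. qcnj (innerR ?d (monom 1 n) (?P k)) * a) (map_poly qcnj (?P k))) =
      map_poly qcnj ?w"
    by (rule poly_eqI) (simp add: coeff_map_poly coeff_sum qcnj_diff qcnj_sum qcnj_mult)
  \<comment> \<open>Conjugation keeps real parts, so both normalizations divide by the same real
    number.\<close>
  also have "normalizeL c (map_poly qcnj ?w) = map_poly qcnj (normalizeR ?d ?w)"
    unfolding normalizeL_def normalizeR_def innerL_map_qcnj[OF assms]
    by (rule poly_eqI) (simp only: coeff_map_poly qcnj_scaleR qcnj_sel qcnj_0 scaleR_zero_right)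
  also have "normalizeR ?d ?w = ?P n"
    by (simp only: orthonormalR.simps[of ?d n])
  finally show ?case .
qed

lemma norm_psiL:
  assumes "positive_definite_seq c"
  shows "norm (psiL c n p) = norm (eval_coeffs_right (orthonormalR (\<lambda>m. c (- m)) n) (qcnj p))"
  by (simp add: psiL_def orthonormalL_eq[OF assms] norm_eval_coeffs_left_qcnj)

text \<open>The conjugation in \<open>reverse_poly\<close> cancels the one relating left and right
  polynomials, so the point is not conjugated here.\<close>

lemma psiL_rev_eq:
  assumes "positive_definite_seq c"
  shows "psiL_rev c n p = eval_coeffs_right (reflectedR c n) p"
proof -
  have "reverse_poly (orthonormalL c n) = reflectedR c n"
    by (simp add: reverse_poly_def reflectedR_def orthonormalL_eq[OF assms] poly_eq_iff
        coeff_map_poly coeff_reflect_poly)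
  then show ?thesis by (simp add: psiL_rev_def)
qed

text \<open>Reversing the sequence twice restores \<open>c\<close>, so the polynomial on the right
  is the plain reflection of \<open>orthonormalR c n\<close>.\<close>

lemma norm_psiR_rev:
  "norm (psiR_rev c n p) = norm (eval_coeffs_right (reflectedR (\<lambda>m. c (- m)) n) (qcnj p))"
  by (simp add: psiR_rev_def reverse_poly_def reflectedR_def norm_eval_coeffs_left_qcnj)

theorem theorem7p1:
  fixes c :: "int \<Rightarrow> quat" and n :: nat and p :: quat
  assumes "nontrivial_positive_definite_seq c"
    and "norm p \<noteq> 1"
  shows "(\<Sum>l\<le>n. (norm (psiL c l p))\<^sup>2 + (norm (psiR c l p))\<^sup>2) =
      ((norm (psiL_rev c (n + 1) p))\<^sup>2 + (norm (psiR_rev c (n + 1) p))\<^sup>2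
        - ((norm (psiL c (n + 1) p))\<^sup>2 + (norm (psiR c (n + 1) p))\<^sup>2)) / (1 - (norm p)\<^sup>2)
    \<and> ((norm (psiL_rev c (n + 1) p))\<^sup>2 + (norm (psiR_rev c (n + 1) p))\<^sup>2
        - ((norm (psiL c (n + 1) p))\<^sup>2 + (norm (psiR c (n + 1) p))\<^sup>2)) / (1 - (norm p)\<^sup>2) =
      ((norm (psiL_rev c n p))\<^sup>2 + (norm (psiR_rev c n p))\<^sup>2
        - (norm p)\<^sup>2 * ((norm (psiL c n p))\<^sup>2 + (norm (psiR c n p))\<^sup>2)) / (1 - (norm p)\<^sup>2)"
proof -
  have pd: "positive_definite_seq c"
    using assms(1) by (simp add: nontrivial_positive_definite_seq_def)
  note eqs = norm_psiL[OF pd] psiL_rev_eq[OF pd] norm_psiR_rev psiR_def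
  note rev = nontrivial_reverse[OF assms(1)]
  let ?S = "\<Sum>l\<le>n. (norm (psiL c l p))\<^sup>2 + (norm (psiR c l p))\<^sup>2"
  let ?A = "(norm (psiL_rev c (n + 1) p))\<^sup>2 + (norm (psiR_rev c (n + 1) p))\<^sup>2
        - ((norm (psiL c (n + 1) p))\<^sup>2 + (norm (psiR c (n + 1) p))\<^sup>2)"
  let ?B = "(norm (psiL_rev c n p))\<^sup>2 + (norm (psiR_rev c n p))\<^sup>2
        - (norm p)\<^sup>2 * ((norm (psiL c n p))\<^sup>2 + (norm (psiR c n p))\<^sup>2)"
  \<comment> \<open>The recursion for \<open>c\<close> at \<open>p\<close> is added to that for the
    reversed sequence at the conjugate point, which has the same modulus.\<close>
  have "?A = ?B"
    using szego_step[OF assms(1), of n p] szego_step[OF rev, of n "qcnj p"]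
    by (simp add: eqs algebra_simps)
  moreover have "(1 - (norm p)\<^sup>2) * ?S = ?B"
    using christoffel_darboux_right[OF assms(1), of p n]
      christoffel_darboux_right[OF rev, of "qcnj p" n]
    by (simp add: eqs sum.distrib algebra_simps)
  moreover have "1 - (norm p)\<^sup>2 \<noteq> 0"
    using assms(2) by (simp add: power2_eq_1_iff) (metis norm_ge_zero neg_0_le_iff_le not_one_le_zero)
  moreover have "s = a / d \<and> a / d = b / d" if "a = b" "d * s = b" "d \<noteq> 0" for a b d s :: real
    using that by auto
  ultimately show ?thesis by blast
qed

end
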